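(* Let $\mathbb{Z}^2_0=\mathbb{Z}^2\setminus\{(0,0)\}$ and let $(a_{i,j})_{(i,j)\in\mathbb{Z}^2_0}$ be real numbers, not all zero, with $a_{i,j}=a_{-i,-j}$ and $\sum_{(i,j)\in\mathbb{Z}^2_0}|a_{i,j}|<\infty$. Let $f\in C^2(\mathbb{R}_+,\mathbb{R})$, $\mathbb{R}_+=[0,\infty)$, with $f(0)=0$. Suppose there are $\bar r_{1,\theta}\in(0,1)$, $T>0$, $\theta\in[0,2\pi)$ and $\nu\in\Phi_\theta(\mathbb{R}\setminus\{0\})\setminus\{0\}$ such that all integer solutions $k_1,k_2,\dots,k_{m_{1,\theta}}$ of the equation $$-\nu=\Phi_\theta\!\left(\tfrac{2\pi}{T}(\bar r_{1,\theta}+k)\right)$$ are either all nonnegative or all negative, and $m_{1,\theta}>0$. Then for any small $\varepsilon>0$ there are $m_{1,\theta}$ branches of nonzero quasi periodic traveling wave solutions $$u_{n,m}(t)=U_{j,\varepsilon}(n\cos\theta+m\sin\theta-\nu_\varepsilon t),\qquad j=1,2,\dots,m_{1,\theta},$$ of $$\imath\,\dot u_{n,m}=\sum_{(i,l)\in\mathbb{Z}^2_0}a_{i,l}\,(u_{n+i,m+l}+u_{n-i,m-l}-2u_{n,m})+f(|u_{n,m}|^2)u_{n,m},\qquad (n,m)\in\mathbb{Z}^2,\ u_{n,m}\in\mathbb{C},$$ with $U_{j,\varepsilon}\in C^1(\mathbb{R},\mathbb{C})$, $j=1,2,\dots,m_{1,\theta}$, and nonzero velocity $\nu_\varepsilon$,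 satisfying $$U_{j,\varepsilon}(z+T)=e^{2\pi\bar r_{1,\theta}\imath}\,U_{j,\varepsilon}(z)\quad\text{for all }z\in\mathbb{R},$$ along with $\nu_\varepsilon\to\nu$ and $U_{j,\varepsilon}\to0$ uniformly on $\mathbb{R}$ as $\varepsilon\to0$.
   Context: $\imath$ is the imaginary unit. For $\theta\in[0,2\pi)$ the function $\Phi_\theta:\mathbb{R}\setminus\{0\}\to\mathbb{R}$ is $$\Phi_\theta(x)=\frac{4}{x}\sum_{(i,j)\in\mathbb{Z}^2_0}a_{i,j}\sin^2\!\left(\frac{x(i\cos\theta+j\sin\theta)}{2}\right).$$ *)

theory Defs
  imports "HOL-Analysis.Analysis"
begin

definition Z2_0 :: "(int \<times> int) set" where
  "Z2_0 = UNIV - {(0, 0)}"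

text \<open>Only the values at \<^term>\<open>x \<noteq> 0\<close> are meaningful (division by zero yields zero).\<close>

definition Phi :: "(int \<Rightarrow> int \<Rightarrow> real) \<Rightarrow> real \<Rightarrow> real \<Rightarrow> real" where
  "Phi a \<theta> x = 4 / x * (\<Sum>\<^sub>\<infinity>(i, j)\<in>Z2_0. a i j *
      (sin (x * (real_of_int i * cos \<theta> + real_of_int j * sin \<theta>) / 2))\<^sup>2)"

text \<open>Twice continuously differentiable on the closed half line, with one-sided derivatives at 0;
  the values at negative arguments are irrelevant.\<close>

definition C2_on_nonneg :: "(real \<Rightarrow> real) \<Rightarrow> bool" where
  "C2_on_nonneg f \<longleftrightarrow> (\<exists>f' f''.
      (\<forall>x\<ge>0. (f has_real_derivative f' x) (at x within {0..})) \<and>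
      (\<forall>x\<ge>0. (f' has_real_derivative f'' x) (at x within {0..})) \<and>
      continuous_on {0..} f'')"

text \<open>The summability clause keeps the infinite sum from taking its default value 0
  on a divergent series.\<close>

definition lattice_solution ::
  "(int \<Rightarrow> int \<Rightarrow> real) \<Rightarrow> (real \<Rightarrow> real) \<Rightarrow> (int \<Rightarrow> int \<Rightarrow> real \<Rightarrow> complex) \<Rightarrow> bool" where
  "lattice_solution a f u \<longleftrightarrow> (\<forall>n m t.
      u n m differentiable (at t) \<and>
      (\<lambda>(i, l). complex_of_real (a i l) * (u (n + i) (m + l) t + u (n - i) (m - l) t - 2 * u n m t))
        summable_on Z2_0 \<and>
      \<i> * vector_derivative (u n m) (at t) =
        (\<Sum>\<^sub>\<infinity>(i, l)\<in>Z2_0. complex_of_real (a i l) *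
            (u (n + i) (m + l) t + u (n - i) (m - l) t - 2 * u n m t))
        + complex_of_real (f ((cmod (u n m t))\<^sup>2)) * u n m t)"

definition traveling_wave ::
  "real \<Rightarrow> real \<Rightarrow> (real \<Rightarrow> complex) \<Rightarrow> int \<Rightarrow> int \<Rightarrow> real \<Rightarrow> complex" where
  "traveling_wave \<theta> v U n m t = U (real_of_int n * cos \<theta> + real_of_int m * sin \<theta> - v * t)"

text \<open>The lattice equation is invariant under time translation and under multiplication by a
  unimodular constant. Profiles differing only by a shift of the argument and a constant phase are
  counted as the same wave; distinct branches may not share a wave in this sense.\<close>

definition same_wave :: "(real \<Rightarrow> complex) \<Rightarrow> (real \<Rightarrow> complex) \<Rightarrow> bool" where
  "same_wave U V \<longleftrightarrow> (\<exists>c s. cmod c = 1 \<and> (\<forall>z. V z = c * U (z + s)))"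

end

theory Submission
  imports Defs
begin

text \<open>A plane wave \<open>A cis (\<omega> z)\<close> has constant modulus, so it solves the nonlinear equation exactly
  as soon as \<open>v = - \<Phi>\<^sub>\<theta> \<omega> + f (A\<^sup>2) / \<omega>\<close>. It is \<open>r\<close>-quasiperiodic for \<open>\<omega> = 2 \<pi> (r + \<kappa>) / T\<close> with
  \<open>\<kappa>\<close> an integer. The branches share the velocity \<open>\<nu> + w\<close> if \<open>f (A\<^sub>j\<^sup>2) = \<omega>\<^sub>j w\<close> for all \<open>j\<close>. As the
  wave numbers \<open>\<omega>\<^sub>j\<close> have the same sign, all \<open>\<omega>\<^sub>j w\<close> lie between 0 and a single value of \<open>f\<close> close
  to 0, and the intermediate value theorem supplies arbitrarily small amplitudes \<open>A\<^sub>j\<close>.\<close>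

section \<open>Plane waves: differences, dispersion relation, quasiperiodicity, distinctness\<close>

definition plane_wave :: "real \<Rightarrow> real \<Rightarrow> real \<Rightarrow> complex" where
  "plane_wave A \<omega> z = complex_of_real A * cis (\<omega> * z)"

lemma plane_wave_has_vector_derivative:
  "(plane_wave A \<omega> has_vector_derivative \<i> * complex_of_real \<omega> * plane_wave A \<omega> z) (at z)"
proof -
  have "((\<lambda>w. complex_of_real A * exp (\<i> * (complex_of_real \<omega> * w))) has_field_derivative
      \<i> * complex_of_real \<omega> * plane_wave A \<omega> z) (at (complex_of_real z))"
    by (auto intro!: derivative_eq_intros simp: plane_wave_def cis_conv_exp)
  from has_vector_derivative_real_field[OF this, of UNIV]
  show ?thesis by (simp add: plane_wave_def[abs_def] cis_conv_exp)
qed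

lemma plane_wave_C1: "plane_wave A \<omega> C1_differentiable_on UNIV"
  unfolding C1_differentiable_on_def
proof (intro exI conjI ballI)
  show "(plane_wave A \<omega> has_vector_derivative \<i> * complex_of_real \<omega> * plane_wave A \<omega> z) (at z)" for z
    by (rule plane_wave_has_vector_derivative)
  show "continuous_on UNIV (\<lambda>z. \<i> * complex_of_real \<omega> * plane_wave A \<omega> z)"
    unfolding plane_wave_def by (intro continuous_intros)
qed

lemma cmod_plane_wave: "cmod (plane_wave A \<omega> z) = \<bar>A\<bar>"
  by (simp add: plane_wave_def norm_mult)

lemma plane_wave_add: "plane_wave A \<omega> (z + d) = cis (\<omega> * d) * plane_wave A \<omega> z"
  by (simp add: plane_wave_def cis_mult ring_distribs add.commute)

text \<open>The half-angle identity \<open>cis x + cis (- x) - 2 = - 4 * (sin (x / 2))^2\<close>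
  makes plane waves eigenfunctions of second differences, with the eigenvalues that are summed in
  \<open>Phi\<close>.\<close>

lemma plane_wave_second_difference:
  "plane_wave A \<omega> (z + d) + plane_wave A \<omega> (z - d) - 2 * plane_wave A \<omega> z
    = complex_of_real (- 4 * (sin (\<omega> * d / 2))\<^sup>2) * plane_wave A \<omega> z"
proof -
  have "cis (\<omega> * d) + cis (\<omega> * - d) - 2 = complex_of_real (2 * cos (2 * (\<omega> * d / 2)) - 2)"
    by (simp add: complex_eq_iff)
  also have "\<dots> = complex_of_real (- 4 * (sin (\<omega> * d / 2))\<^sup>2)"
    by (simp only: cos_double_sin) simp
  finally show ?thesis
    using plane_wave_add[of A \<omega> z d] plane_wave_add[of A \<omega> z "- d"]
    by (metis left_diff_distrib distrib_right diff_conv_add_uminus)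
qed

text \<open>On a plane wave every term of the equation is a real multiple of the wave itself: the
  time derivative gives \<open>v * \<omega>\<close>, the coupling
  \<open>- \<omega> * Phi a \<theta> \<omega>\<close>, and the nonlinearity \<open>f (A^2)\<close>,
  the modulus being constant.\<close>

lemma plane_wave_lattice_solution:
  assumes a_summable: "(\<lambda>(i, j). \<bar>a i j\<bar>) summable_on Z2_0"
    and "\<omega> \<noteq> 0" and dispersion: "v * \<omega> = - \<omega> * Phi a \<theta> \<omega> + f (A\<^sup>2)"
  shows "lattice_solution a f (traveling_wave \<theta> v (plane_wave A \<omega>))"
  unfolding lattice_solution_def
proof (intro allI conjI)
  fix n m :: int and t :: real
  let ?u = "traveling_wave \<theta> v (plane_wave A \<omega>)"
  let ?d = "\<lambda>i l. real_of_int i * cos \<theta> + real_of_int l * sin \<theta>"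
  let ?g = "\<lambda>(i, l). a i l * (sin (\<omega> * ?d i l / 2))\<^sup>2"
  have deriv: "(?u n m has_vector_derivative - v *\<^sub>R (\<i> * complex_of_real \<omega> * ?u n m t)) (at t)"
  proof -
    have "((\<lambda>t. ?d n m - v * t) has_vector_derivative - v) (at t)"
      by (auto intro!: derivative_eq_intros)
    from vector_diff_chain_at[OF this plane_wave_has_vector_derivative, of A \<omega>]
    show ?thesis by (simp add: traveling_wave_def[abs_def] o_def)
  qed
  then show "?u n m differentiable (at t)"
    by (rule differentiableI_vector)
  have second_difference: "?u (n + i) (m + l) t + ?u (n - i) (m - l) t - 2 * ?u n m t
      = complex_of_real (- 4 * (sin (\<omega> * ?d i l / 2))\<^sup>2) * ?u n m t" for i l
    using plane_wave_second_difference[of A \<omega> "?d n m - v * t" "?d i l"]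
    by (simp add: traveling_wave_def algebra_simps)
  have coupling: "(\<lambda>(i, l). complex_of_real (a i l) *
        (?u (n + i) (m + l) t + ?u (n - i) (m - l) t - 2 * ?u n m t))
      = (\<lambda>p. complex_of_real (?g p) * (- 4 * ?u n m t))"
    unfolding second_difference by (auto simp: fun_eq_iff)
  \<comment> \<open>Domination by the absolutely summable \<open>a\<close>, as the squared sine is
    at most 1.\<close>
  have "?g summable_on Z2_0"
  proof (rule abs_summable_summable[OF Infinite_Sum.abs_summable_on_comparison_test'])
    show "(\<lambda>(i, j). \<bar>a i j\<bar>) summable_on Z2_0" by fact
    show "norm (?g p) \<le> (\<lambda>(i, j). \<bar>a i j\<bar>) p" for p
      by (auto simp: abs_mult power_le_one_iff abs_square_le_1 intro!: mult_left_le split: prod.split)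
  qed
  then have sum_g: "(?g has_sum infsum ?g Z2_0) Z2_0" by simp
  then have sum: "((\<lambda>p. complex_of_real (?g p) * (- 4 * ?u n m t)) has_sum
      complex_of_real (infsum ?g Z2_0) * (- 4 * ?u n m t)) Z2_0"
    by (intro has_sum_cmult_left has_sum_of_real)
  show "(\<lambda>(i, l). complex_of_real (a i l) *
        (?u (n + i) (m + l) t + ?u (n - i) (m - l) t - 2 * ?u n m t)) summable_on Z2_0"
    unfolding coupling using sum by (rule has_sum_imp_summable)
  have Phi: "\<omega> * Phi a \<theta> \<omega> = 4 * infsum ?g Z2_0"
    using \<open>\<omega> \<noteq> 0\<close> by (simp add: Phi_def)
  have modulus: "(cmod (?u n m t))\<^sup>2 = A\<^sup>2"
    by (simp add: traveling_wave_def cmod_plane_wave)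
  have "\<i> * vector_derivative (?u n m) (at t) = complex_of_real (v * \<omega>) * ?u n m t"
    unfolding vector_derivative_at[OF deriv] by (simp add: scaleR_conv_of_real mult_ac)
  also have "v * \<omega> = infsum ?g Z2_0 * (- 4) + f (A\<^sup>2)"
    using dispersion Phi by simp
  also have "complex_of_real \<dots> * ?u n m t = complex_of_real (infsum ?g Z2_0) * (- 4 * ?u n m t)
      + complex_of_real (f (A\<^sup>2)) * ?u n m t"
    by (simp add: left_diff_distrib)
  also have "complex_of_real (infsum ?g Z2_0) * (- 4 * ?u n m t)
      = (\<Sum>\<^sub>\<infinity>p\<in>Z2_0. complex_of_real (?g p) * (- 4 * ?u n m t))"
    using infsumI[OF sum] by simp
  finally show "\<i> * vector_derivative (?u n m) (at t) =
      (\<Sum>\<^sub>\<infinity>(i, l)\<in>Z2_0. complex_of_real (a i l) *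
          (?u (n + i) (m + l) t + ?u (n - i) (m - l) t - 2 * ?u n m t))
      + complex_of_real (f ((cmod (?u n m t))\<^sup>2)) * ?u n m t"
    unfolding coupling modulus .
qed

text \<open>Over one period \<open>T\<close> the integer \<open>\<kappa>\<close> contributes only
  full turns to the phase.\<close>

lemma plane_wave_quasiperiodic:
  assumes "T \<noteq> 0"
  shows "plane_wave A (2 * pi / T * (r + real_of_int \<kappa>)) (z + T)
    = exp (complex_of_real (2 * pi * r) * \<i>) * plane_wave A (2 * pi / T * (r + real_of_int \<kappa>)) z"
proof -
  have "2 * pi / T * (r + real_of_int \<kappa>) * T = 2 * pi * r + 2 * pi * real_of_int \<kappa>"
    using assms by (simp add: field_simps)
  then have "cis (2 * pi / T * (r + real_of_int \<kappa>) * T) = cis (2 * pi * r)"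
    by (simp flip: cis_mult)
  then show ?thesis
    by (simp only: plane_wave_add cis_conv_exp mult.commute)
qed

text \<open>Shifts and constant factors preserve the multiplier \<open>cis (\<omega> * d)\<close>
  acquired under translation by \<open>d\<close>, and the multipliers for all \<open>d\<close>
  determine the wave number.\<close>

lemma same_wave_plane_wave_imp_eq:
  assumes "same_wave (plane_wave A \<omega>) (plane_wave B \<mu>)" and "B \<noteq> 0"
  shows "\<omega> = \<mu>"
proof (rule ccontr)
  assume "\<omega> \<noteq> \<mu>"
  \<comment> \<open>At this translation the two phases differ by exactly \<open>pi\<close>, so the
    multipliers are opposite.\<close>
  define d where "d = pi / (\<mu> - \<omega>)"
  obtain c s where eq: "\<And>z. plane_wave B \<mu> z = c * plane_wave A \<omega> (z + s)"
    using assms(1) unfolding same_wave_def by blast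
  have "cis (\<mu> * d) * plane_wave B \<mu> 0 = plane_wave B \<mu> (0 + d)"
    by (simp only: plane_wave_add)
  also have "\<dots> = c * plane_wave A \<omega> (s + d)"
    unfolding eq by (simp add: add.commute)
  also have "\<dots> = cis (\<omega> * d) * (c * plane_wave A \<omega> (0 + s))"
    unfolding plane_wave_add[of _ _ s] by simp
  also have "\<dots> = cis (\<omega> * d) * plane_wave B \<mu> 0"
    unfolding eq ..
  finally have "cis (\<mu> * d) = cis (\<omega> * d)"
    using \<open>B \<noteq> 0\<close> by (simp add: plane_wave_def)
  moreover have "\<mu> * d = \<omega> * d + pi"
    using \<open>\<omega> \<noteq> \<mu>\<close> by (simp add: d_def field_simps)
  ultimately show False
    by (simp flip: cis_mult)
qed

section \<open>Choice of amplitudes for a common velocity\<close>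

text \<open>Here \<open>L\<close> holds the wave numbers, \<open>w\<close> is the common velocity
  shift and \<open>s \<omega>\<close> a squared amplitude.\<close>

lemma small_solutions_of_proportional_levels:
  fixes f :: "real \<Rightarrow> real"
  assumes f: "continuous_on {0..} f" "f 0 = 0"
    and L: "finite L" and sign: "(\<forall>\<omega>\<in>L. 0 < \<omega>) \<or> (\<forall>\<omega>\<in>L. \<omega> < 0)"
    and e: "0 < e"
  shows "\<exists>w s. \<bar>w\<bar> < e \<and> (\<forall>\<omega>\<in>L. 0 < s \<omega> \<and> s \<omega> < e \<and> f (s \<omega>) = \<omega> * w)"
proof (cases "L = {}")
  case True
  then show ?thesis
    using e by (intro exI[of _ 0] exI[of _ "\<lambda>_. e / 2"]) auto
next
  case False
  \<comment> \<open>Normalising by the largest modulus keeps every ratio \<open>q\<close> below in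
    (0, 1]. The empty set was split off because \<open>Max\<close> needs an element.\<close>
  define \<Lambda> where "\<Lambda> = Max (abs ` L)"
  have "\<Lambda> \<in> abs ` L"
    unfolding \<Lambda>_def using L False by (intro Max_in) auto
  then have \<Lambda>_pos: "\<Lambda> > 0" using sign by auto
  have le_\<Lambda>: "\<bar>\<omega>\<bar> \<le> \<Lambda>" if "\<omega> \<in> L" for \<omega>
    unfolding \<Lambda>_def using L that by auto
  from sign obtain \<sigma> :: real where \<sigma>: "\<And>\<omega>. \<omega> \<in> L \<Longrightarrow> \<sigma> * \<omega> = \<bar>\<omega>\<bar> \<and> \<omega> \<noteq> 0" "\<bar>\<sigma>\<bar> = 1"
  proof
    assume "\<forall>\<omega>\<in>L. 0 < \<omega>"
    then show thesis by (intro that[of 1]) auto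
  next
    assume "\<forall>\<omega>\<in>L. \<omega> < 0"
    then show thesis by (intro that[of "-1"]) auto
  qed
  \<comment> \<open>The tolerance \<open>e * \<Lambda>\<close> is what makes \<open>w\<close>, a
    value of \<open>f\<close> divided by \<open>\<Lambda>\<close> up to sign, smaller than
    \<open>e\<close>.\<close>
  have "0 < e * \<Lambda>" "(0::real) \<in> {0..}" using e \<Lambda>_pos by auto
  then obtain \<delta> where "\<delta> > 0" "\<forall>x\<in>{0..}. dist x 0 < \<delta> \<longrightarrow> dist (f x) (f 0) < e * \<Lambda>"
    using f(1) unfolding continuous_on_iff by metis
  then have \<delta>: "\<delta> > 0" "\<And>x. 0 \<le> x \<Longrightarrow> x < \<delta> \<Longrightarrow> \<bar>f x\<bar> < e * \<Lambda>"
    using f(2) by (auto simp: dist_real_def)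
  show ?thesis
  proof (cases "\<forall>x\<in>{0<..<min \<delta> e}. f x = 0")
    \<comment> \<open>If \<open>f\<close> vanishes near 0, no velocity shift is needed and any small
      amplitude works.\<close>
    case True
    then show ?thesis
      using e \<delta>(1) by (intro exI[of _ 0] exI[of _ "\<lambda>_. min \<delta> e / 2"]) (auto simp del: min_less_iff_conj)
  next
    case False
    then obtain x where x: "0 < x" "x < \<delta>" "x < e" "f x \<noteq> 0" by auto
    define w where "w = \<sigma> * f x / \<Lambda>"
    have "\<bar>w\<bar> < e"
      using \<delta>(2)[of x] x \<sigma>(2) \<Lambda>_pos by (simp add: w_def abs_mult field_simps)
    moreover have "\<exists>s. 0 < s \<and> s < e \<and> f s = \<omega> * w" if \<omega>: "\<omega> \<in> L" for \<omega>
    proof -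
      define q where "q = \<bar>\<omega>\<bar> / \<Lambda>"
      have q: "0 < q" "q \<le> 1"
        using \<sigma>(1)[OF \<omega>] le_\<Lambda>[OF \<omega>] \<Lambda>_pos by (auto simp: q_def)
      \<comment> \<open>The common sign \<open>\<sigma>\<close> turns \<open>\<omega>\<close> into
        its modulus, so each target level lies between 0 and \<open>f x\<close>.\<close>
      have level: "\<omega> * w = q * f x"
        using \<sigma>(1)[OF \<omega>] by (simp add: w_def q_def mult_ac)
      have cont: "continuous_on {0..x} f"
        using f(1) by (rule continuous_on_subset) auto
      have "\<exists>s\<ge>0. s \<le> x \<and> f s = q * f x"
      proof (cases "f x > 0")
        case True
        then show ?thesis
          using q x f(2) cont by (intro IVT') auto
      next
        case False
        then have "f x < 0" using x by simp
        then have "f x \<le> q * f x"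
          using q mult_right_mono_neg[of q 1 "f x"] by simp
        then show ?thesis
          using q x f(2) cont \<open>f x < 0\<close> by (intro IVT2') (auto simp: mult_le_0_iff)
      qed
      then obtain s where s: "s \<ge> 0" "s \<le> x" "f s = q * f x" by blast
      \<comment> \<open>The target level is nonzero whereas \<open>f 0 = 0\<close>.\<close>
      then have "s \<noteq> 0" using f(2) q x by auto
      then show ?thesis using s x level by (intro exI[of _ s]) auto
    qed
    ultimately show ?thesis by metis
  qed
qed

lemma C2_on_nonneg_imp_continuous_on: "C2_on_nonneg f \<Longrightarrow> continuous_on {0..} f"
  unfolding C2_on_nonneg_def by (auto intro: DERIV_continuous_on)

section \<open>Assembly of the branches\<close>

theorem theorem4p2:
  fixes a :: "int \<Rightarrow> int \<Rightarrow> real" and f :: "real \<Rightarrow> real"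
    and r T \<theta> \<nu> :: real and k :: "nat \<Rightarrow> int" and m\<^sub>1 :: nat
  assumes a_nonzero: "\<exists>(i, j)\<in>Z2_0. a i j \<noteq> 0"
    and a_sym: "\<forall>(i, j)\<in>Z2_0. a i j = a (- i) (- j)"
    and a_summable: "(\<lambda>(i, j). \<bar>a i j\<bar>) summable_on Z2_0"
    and f_C2: "C2_on_nonneg f" and f_0: "f 0 = 0"
    and r: "0 < r" "r < 1" and T: "T > 0" and \<theta>: "0 \<le> \<theta>" "\<theta> < 2 * pi"
    and \<nu>: "\<nu> \<in> Phi a \<theta> ` (UNIV - {0}) - {0}"
    and k_all: "bij_betw k {1..m\<^sub>1}
                  {\<kappa> :: int. - \<nu> = Phi a \<theta> (2 * pi / T * (r + real_of_int \<kappa>))}"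
    and k_sign: "(\<forall>j\<in>{1..m\<^sub>1}. k j \<ge> 0) \<or> (\<forall>j\<in>{1..m\<^sub>1}. k j < 0)"
    and m\<^sub>1_pos: "m\<^sub>1 > 0"
  shows "\<exists>\<epsilon>\<^sub>0>0. \<exists>(U :: nat \<Rightarrow> real \<Rightarrow> real \<Rightarrow> complex) (v :: real \<Rightarrow> real).
      (\<forall>\<epsilon>\<in>{0<..<\<epsilon>\<^sub>0}. v \<epsilon> \<noteq> 0 \<and>
         (\<forall>j\<in>{1..m\<^sub>1}.
            U j \<epsilon> C1_differentiable_on UNIV \<and>
            (\<exists>z. U j \<epsilon> z \<noteq> 0) \<and>
            lattice_solution a f (traveling_wave \<theta> (v \<epsilon>) (U j \<epsilon>)) \<and>
            (\<forall>z. U j \<epsilon> (z + T) = exp (complex_of_real (2 * pi * r) * \<i>) * U j \<epsilon> z))) \<and>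
      (\<forall>j\<in>{1..m\<^sub>1}. \<forall>j'\<in>{1..m\<^sub>1}. j \<noteq> j' \<longrightarrow>
         (\<forall>\<epsilon>\<in>{0<..<\<epsilon>\<^sub>0}. \<forall>\<epsilon>'\<in>{0<..<\<epsilon>\<^sub>0}. \<not> same_wave (U j \<epsilon>) (U j' \<epsilon>'))) \<and>
      (v \<longlongrightarrow> \<nu>) (at_right 0) \<and>
      (\<forall>j\<in>{1..m\<^sub>1}. uniform_limit UNIV (U j) (\<lambda>z. 0) (at_right 0))"
proof -
  define \<omega> where "\<omega> j = 2 * pi / T * (r + real_of_int (k j))" for j
  have k_sol: "- \<nu> = Phi a \<theta> (\<omega> j)" if "j \<in> {1..m\<^sub>1}" for j
    using bij_betwE[OF k_all] that unfolding \<omega>_def by blast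
  have \<omega>_inj: "\<omega> j \<noteq> \<omega> j'" if "j \<in> {1..m\<^sub>1}" "j' \<in> {1..m\<^sub>1}" "j \<noteq> j'" for j j'
  proof -
    have "k j \<noteq> k j'"
      using inj_onD[OF bij_betw_imp_inj_on[OF k_all] _ that(1,2)] that(3) by blast
    then show ?thesis
      using T by (simp add: \<omega>_def)
  qed
  \<comment> \<open>Since \<open>r\<close> lies strictly between 0 and 1 and \<open>k j < 0\<close>
    means \<open>k j \<le> - 1\<close>, the sign condition on the integers passes to the wave
    numbers, none of which is 0.\<close>
  have \<omega>_sign: "(\<forall>x\<in>\<omega> ` {1..m\<^sub>1}. 0 < x) \<or> (\<forall>x\<in>\<omega> ` {1..m\<^sub>1}. x < 0)"
    using k_sign
  proof
    assume "\<forall>j\<in>{1..m\<^sub>1}. k j \<ge> 0"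
    then have "0 < r + real_of_int (k j)" if "j \<in> {1..m\<^sub>1}" for j
      using that r by (simp add: add_pos_nonneg)
    then show ?thesis
      using T by (auto simp: \<omega>_def)
  next
    assume neg: "\<forall>j\<in>{1..m\<^sub>1}. k j < 0"
    have "r + real_of_int (k j) < 0" if "j \<in> {1..m\<^sub>1}" for j
    proof -
      have "k j \<le> - 1" using neg that by force
      then show ?thesis using r by linarith
    qed
    then show ?thesis
      using T by (auto simp: \<omega>_def mult_less_0_iff divide_less_0_iff)
  qed
  \<comment> \<open>Keeping \<open>e > 0\<close> under the existential allows \<open>w\<close> and
    \<open>s\<close> to be chosen as total functions of \<open>e\<close>, which becomes the branch
    parameter.\<close>
  have "\<forall>e. \<exists>w s. e > 0 \<longrightarrow> \<bar>w\<bar> < e \<and>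
      (\<forall>x\<in>\<omega> ` {1..m\<^sub>1}. 0 < s x \<and> s x < e \<and> f (s x) = x * w)"
    using small_solutions_of_proportional_levels
      [OF C2_on_nonneg_imp_continuous_on[OF f_C2] f_0 _ \<omega>_sign]
    by (metis finite_imageI finite_atLeastAtMost)
  then obtain w s where w_s: "\<And>e. e > 0 \<Longrightarrow> \<bar>w e\<bar> < e \<and>
      (\<forall>x\<in>\<omega> ` {1..m\<^sub>1}. 0 < s e x \<and> s e x < e \<and> f (s e x) = x * w e)"
    by metis
  have w: "\<bar>w e\<bar> < e" if "e > 0" for e
    using w_s that by blast
  have s: "0 < s e (\<omega> j)" "s e (\<omega> j) < e" "f (s e (\<omega> j)) = \<omega> j * w e"
    if "e > 0" "j \<in> {1..m\<^sub>1}" for e j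
    using w_s that by blast+
  \<comment> \<open>The square root enters because \<open>f\<close> is evaluated at the squared
    modulus.\<close>
  define U where "U j e = plane_wave (sqrt (s e (\<omega> j))) (\<omega> j)" for j e
  have \<nu>_pos: "0 < \<bar>\<nu>\<bar>" using \<nu> by auto
  show ?thesis
  \<comment> \<open>With the bound \<open>\<bar>\<nu>\<bar>\<close> on the parameter, the shift
    \<open>w e\<close> cannot cancel \<open>\<nu>\<close>.\<close>
  proof ((rule exI[of _ "\<bar>\<nu>\<bar>"] conjI[OF \<nu>_pos] exI[of _ U] exI[of _ "\<lambda>e. \<nu> + w e"])+,
      intro conjI ballI allI impI)
    fix e assume "e \<in> {0<..<\<bar>\<nu>\<bar>}"
    then show "\<nu> + w e \<noteq> 0" using w[of e] by auto
  next
    fix e j assume "e \<in> {0<..<\<bar>\<nu>\<bar>}" and j: "j \<in> {1..m\<^sub>1}"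
    then have e: "e > 0" by simp
    show "U j e C1_differentiable_on UNIV"
      unfolding U_def by (rule plane_wave_C1)
    show "\<exists>z. U j e z \<noteq> 0"
      using s(1)[OF e j] by (auto simp: U_def plane_wave_def)
    show "lattice_solution a f (traveling_wave \<theta> (\<nu> + w e) (U j e))"
      unfolding U_def using a_summable
    proof (rule plane_wave_lattice_solution)
      show "\<omega> j \<noteq> 0" using \<omega>_sign j by (metis imageI less_irrefl)
      \<comment> \<open>As \<open>Phi\<close> equals \<open>- \<nu>\<close> at
        \<open>\<omega> j\<close>, this reduces to
        \<open>f (s e (\<omega> j)) = \<omega> j * w e\<close>.\<close>
      show "(\<nu> + w e) * \<omega> j = - \<omega> j * Phi a \<theta> (\<omega> j) + f ((sqrt (s e (\<omega> j)))\<^sup>2)"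
        using s[OF e j] by (simp add: k_sol[OF j, symmetric] algebra_simps)
    qed
    show "U j e (z + T) = exp (complex_of_real (2 * pi * r) * \<i>) * U j e z" for z
      unfolding U_def \<omega>_def using T by (intro plane_wave_quasiperiodic) simp
  next
    fix j j' e e'
    assume "j \<in> {1..m\<^sub>1}" "j' \<in> {1..m\<^sub>1}" "j \<noteq> j'" "e' \<in> {0<..<\<bar>\<nu>\<bar>}"
    then show "\<not> same_wave (U j e) (U j' e')"
      using same_wave_plane_wave_imp_eq \<omega>_inj[of j j'] s(1)[of e' j']
      unfolding U_def by (metis greaterThanLessThan_iff less_irrefl real_sqrt_gt_0_iff)
  next
    have "(w \<longlongrightarrow> 0) (at_right 0)"
    proof (rule Lim_null_comparison)
      show "\<forall>\<^sub>F e in at_right 0. norm (w e) \<le> e"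
        using w by (intro eventually_at_rightI[of 0 1]) (auto intro: less_imp_le)
    qed (rule tendsto_ident_at)
    then show "((\<lambda>e. \<nu> + w e) \<longlongrightarrow> \<nu>) (at_right 0)"
      using tendsto_add[OF tendsto_const] by force
  next
    fix j assume j: "j \<in> {1..m\<^sub>1}"
    show "uniform_limit UNIV (U j) (\<lambda>z. 0) (at_right 0)"
      unfolding uniform_limit_iff
    proof (intro allI impI)
      fix d :: real assume d: "d > 0"
      show "\<forall>\<^sub>F e in at_right 0. \<forall>z\<in>UNIV. dist (U j e z) 0 < d"
      proof (rule eventually_at_rightI)
        \<comment> \<open>The modulus of the profile is constantly
          \<open>sqrt (s e (\<omega> j))\<close>, which is below \<open>sqrt e\<close>; hence the
          threshold is the square of \<open>d\<close>.\<close>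
        show "0 < d\<^sup>2" using d by simp
        fix e assume "e \<in> {0<..<d\<^sup>2}"
        then have "0 < s e (\<omega> j)" "s e (\<omega> j) < d\<^sup>2"
          using s[of e j] j by auto
        then have "sqrt (s e (\<omega> j)) < d"
          using d by (intro real_less_lsqrt) auto
        then show "\<forall>z\<in>UNIV. dist (U j e z) 0 < d"
          using \<open>0 < s e (\<omega> j)\<close> by (simp add: U_def cmod_plane_wave)
      qed
    qed
  qed
qed

end
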